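(* (1) Let $(X,d)$ be an unbounded ultrametric space, let $d^{*}\in(0,\infty)$, and let $\rho\colon X\times X\to[0,\infty)$ be defined by $$\rho(x,y)=\frac{d^{*}\cdot d(x,y)}{1+d(x,y)}.$$ Then $(X,\rho)$ is a bounded ultrametric space with empty diametrical graph $G_{X,\rho}$. (2) Conversely, let $(X,\rho)$ be a bounded ultrametric space with $|X|\geq 2$ and empty diametrical graph $G_{X,\rho}$. Write $d^{*}=\operatorname{diam}(X,\rho)$. Then there is an unbounded ultrametric space $(X,d)$ (on the same set $X$) such that $$\rho(x,y)=\frac{d^{*}\cdot d(x,y)}{1+d(x,y)}$$ holds for all $x,y\in X$.
   Context: An ultrametric on $X$ is a metric $d$ with $d(x,y)\leq\max\{d(x,z),d(z,y)\}$ for all $x,y,z\in X$. For a metric space $(X,d)$, $\operatorname{diam}(X,d)=\sup\{d(x,y):x,y\in X\}\in[0,\infty]$; the space is bounded if this is finite and unbounded otherwise. The diametrical graph $G_{X,d}$ is the simple graph with vertex set $X$ in which $\{u,v\}$ is an edge iff $u\neq v$ and $d(u,v)=\operatorname{diam}(X,d)$. A graph is empty if it has no edges. *)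

theory Defs
  imports "HOL-Analysis.Analysis"
begin

(* As in Metric_space, the distance is a function on the whole type that is nonnegative and
   symmetric everywhere; an ultrametric given only on X extends by 0 outside X. *)
locale Ultrametric_space = Metric_space X d
  for X :: "'a set" and d :: "'a \<Rightarrow> 'a \<Rightarrow> real" +
  assumes ultra: "\<lbrakk>x \<in> X; y \<in> X; z \<in> X\<rbrakk> \<Longrightarrow> d x y \<le> max (d x z) (d z y)"

(* Valued in [0, \<infinity>]; the library's real-valued diameter is tied to the metric type class and
   carries no information for unbounded sets. *)
definition diam :: "'a set \<Rightarrow> ('a \<Rightarrow> 'a \<Rightarrow> real) \<Rightarrow> ennreal" where
  "diam X d = (SUP (x, y)\<in>X \<times> X. ennreal (d x y))"

definition bounded_space :: "'a set \<Rightarrow> ('a \<Rightarrow> 'a \<Rightarrow> real) \<Rightarrow> bool" where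
  "bounded_space X d \<longleftrightarrow> diam X d < \<infinity>"

(* A simple graph is a pair of its vertex set and its set of two-element edges. *)
type_synonym 'a sgraph = "'a set \<times> 'a set set"

definition diametrical_graph :: "'a set \<Rightarrow> ('a \<Rightarrow> 'a \<Rightarrow> real) \<Rightarrow> 'a sgraph" where
  "diametrical_graph X d =
     (X, {{u, v} | u v. u \<in> X \<and> v \<in> X \<and> u \<noteq> v \<and> ennreal (d u v) = diam X d})"

definition empty_graph :: "'a sgraph \<Rightarrow> bool" where
  "empty_graph G \<longleftrightarrow> snd G = {}"

end

theory Submission
  imports Defs
begin

text \<open>
  The map \<open>t \<mapsto> d\<^sup>* t / (1 + t)\<close> is a strictly increasing bijection from \<open>[0, \<infinity>)\<close> onto
  \<open>[0, d\<^sup>*)\<close> with inverse \<open>s \<mapsto> s / (d\<^sup>* - s)\<close>, and strictly increasing maps fixing 0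
  preserve ultrametrics. Emptiness of the diametrical graph says that the supremum of the distances
  is not attained; under the bijection this corresponds to unboundedness.
\<close>

text \<open>Monotonicity transports the strong triangle inequality, and injectivity with
  \<open>f 0 = 0\<close> keeps distinct points apart. The set \<open>S\<close> is a parameter
  because the two maps have different domains. Sign and symmetry of \<open>r\<close> are assumed
  separately, since \<open>Metric_space\<close> demands them also off \<open>X\<close>, where
  \<open>r\<close> need not be \<open>f\<close> of \<open>d\<close>.\<close>

lemma Ultrametric_space_strict_mono:
  assumes "Ultrametric_space X d"
    and f: "strict_mono_on S f" "f 0 = 0" "0 \<in> S"
    and dS: "\<And>x y. \<lbrakk>x \<in> X; y \<in> X\<rbrakk> \<Longrightarrow> d x y \<in> S"
    and r: "\<And>x y. \<lbrakk>x \<in> X; y \<in> X\<rbrakk> \<Longrightarrow> r x y = f (d x y)"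
    and r_nonneg: "\<And>x y. 0 \<le> r x y"
    and r_commute: "\<And>x y. r x y = r y x"
  shows "Ultrametric_space X r"
proof -
  interpret Ultrametric_space X d by fact
  have ultra_r: "r x y \<le> max (r x z) (r z y)" if "x \<in> X" "y \<in> X" "z \<in> X" for x y z
  proof -
    have "mono_on S f" using f(1) by (rule strict_mono_on_imp_mono_on)
    \<comment> \<open>Splitting the maximum into a disjunction lets \<open>f\<close> act on one
      comparison at a time.\<close>
    moreover have "d x y \<le> d x z \<or> d x y \<le> d z y" using ultra[OF that] by linarith
    ultimately have "f (d x y) \<le> f (d x z) \<or> f (d x y) \<le> f (d z y)"
      using dS that by (meson mono_onD)
    then show ?thesis using r that by auto
  qed
  show ?thesis
  proof
    show "r x y = 0 \<longleftrightarrow> x = y" if "x \<in> X" "y \<in> X" for x y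
    proof -
      have "r x y = 0 \<longleftrightarrow> f (d x y) = f 0" using r f that by simp
      also have "\<dots> \<longleftrightarrow> d x y = 0"
        using strict_mono_on_imp_inj_on[OF f(1)] dS f(3) that by (auto dest: inj_onD)
      finally show ?thesis using that by simp
    qed
    \<comment> \<open>The maximum of two nonnegative numbers is at most their sum.\<close>
    show "r x z \<le> r x y + r y z" if "x \<in> X" "y \<in> X" "z \<in> X" for x y z
      using ultra_r[of x z y] r_nonneg[of x y] r_nonneg[of y z] that by linarith
  qed (use r_nonneg r_commute ultra_r in auto)
qed

lemma diam_le_ennreal_iff:
  assumes "0 \<le> M"
  shows "diam X d \<le> ennreal M \<longleftrightarrow> (\<forall>x\<in>X. \<forall>y\<in>X. d x y \<le> M)"
  using assms by (auto simp: diam_def SUP_le_iff)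

lemma ennreal_le_diam:
  assumes "x \<in> X" "y \<in> X"
  shows "ennreal (d x y) \<le> diam X d"
  unfolding diam_def using assms by (intro SUP_upper2[of "(x, y)"]) auto

lemma bounded_space_iff: "bounded_space X d \<longleftrightarrow> (\<exists>M\<ge>0. \<forall>x\<in>X. \<forall>y\<in>X. d x y \<le> M)"
proof -
  have "bounded_space X d \<longleftrightarrow> (\<exists>M\<ge>0. diam X d \<le> ennreal M)"
    unfolding bounded_space_def
    by (cases "diam X d") (auto intro: le_less_trans simp: top_unique)
  then show ?thesis by (simp add: diam_le_ennreal_iff cong: conj_cong)
qed

text \<open>A distance never exceeds the diameter, so failing to equal it means lying strictly below
  it.\<close>

lemma empty_diametrical_graph_iff:
  "empty_graph (diametrical_graph X d) \<longleftrightarrow>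
    (\<forall>u\<in>X. \<forall>v\<in>X. u \<noteq> v \<longrightarrow> ennreal (d u v) < diam X d)"
  unfolding empty_graph_def diametrical_graph_def
  by (auto simp: less_le ennreal_le_diam)

lemma strict_mono_on_bounding_map:
  fixes D :: real
  assumes "0 < D"
  shows "strict_mono_on {0..} (\<lambda>t. D * t / (1 + t))"
  using assms by (auto intro!: strict_mono_onI simp: field_simps)

text \<open>The numerator grows while the denominator shrinks and stays positive.\<close>

lemma strict_mono_on_unbounding_map: "strict_mono_on {0..<D} (\<lambda>s::real. s / (D - s))"
proof (rule strict_mono_onI)
  fix r s assume "r \<in> {0..<D}" "s \<in> {0..<D}" "r < s"
  then show "r / (D - r) < s / (D - s)" by (intro frac_less) auto
qed

lemma unbounding_map_inverse:
  fixes D s :: real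
  assumes "0 < D" "s < D"
  shows "D * (s / (D - s)) / (1 + s / (D - s)) = s"
proof -
  have "1 + s / (D - s) = D / (D - s)" using assms by (simp add: field_simps)
  then show ?thesis using assms by simp
qed

theorem theorem3p15:
  fixes X :: "'a set"
  shows
    "(\<forall>(d :: 'a \<Rightarrow> 'a \<Rightarrow> real) (dstar :: real) (\<rho> :: 'a \<Rightarrow> 'a \<Rightarrow> real).
        Ultrametric_space X d \<and> \<not> bounded_space X d \<and> 0 < dstar \<and>
        \<rho> = (\<lambda>x y. dstar * d x y / (1 + d x y)) \<longrightarrow>
        Ultrametric_space X \<rho> \<and> bounded_space X \<rho> \<and> empty_graph (diametrical_graph X \<rho>))
     \<and>
     (\<forall>(\<rho> :: 'a \<Rightarrow> 'a \<Rightarrow> real) (dstar :: real).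
        Ultrametric_space X \<rho> \<and> bounded_space X \<rho> \<and> (infinite X \<or> 2 \<le> card X) \<and>
        empty_graph (diametrical_graph X \<rho>) \<and> dstar = enn2real (diam X \<rho>) \<longrightarrow>
        (\<exists>d :: 'a \<Rightarrow> 'a \<Rightarrow> real.
           Ultrametric_space X d \<and> \<not> bounded_space X d \<and>
           (\<forall>x\<in>X. \<forall>y\<in>X. \<rho> x y = dstar * d x y / (1 + d x y))))"
proof (intro conjI allI impI; elim conjE)
  fix d \<rho> :: "'a \<Rightarrow> 'a \<Rightarrow> real" and D :: real
  assume d: "Ultrametric_space X d" and unbounded: "\<not> bounded_space X d"
    and D: "0 < D" and \<rho>: "\<rho> = (\<lambda>x y. D * d x y / (1 + d x y))"
  interpret Ultrametric_space X d by fact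
  show "Ultrametric_space X \<rho>"
    using d strict_mono_on_bounding_map[OF D]
    by (rule Ultrametric_space_strict_mono) (use D commute in \<open>auto simp: \<rho>\<close>)
  have "\<rho> x y \<le> D" for x y
    using D nonneg[of x y] by (simp add: \<rho> pos_divide_le_eq add_pos_nonneg algebra_simps)
  then show "bounded_space X \<rho>"
    using D unfolding bounded_space_iff by (intro exI[of _ D]) auto
  show "empty_graph (diametrical_graph X \<rho>)"
    unfolding empty_diametrical_graph_iff
  proof (intro ballI impI)
    fix u v
    \<comment> \<open>The number \<open>d u v\<close> is itself a candidate bound \<open>M\<close>;
      unboundedness refutes it by a pair that is farther apart.\<close>
    obtain x y where xy: "x \<in> X" "y \<in> X" "d u v < d x y"
      using unbounded nonneg[of u v] unfolding bounded_space_iff not_ex de_Morgan_conj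
      by (metis not_le)
    have "\<rho> u v < \<rho> x y"
      using strict_mono_onD[OF strict_mono_on_bounding_map[OF D] _ _ xy(3)] by (simp add: \<rho>)
    then have "ennreal (\<rho> u v) < ennreal (\<rho> x y)"
      using D by (simp add: \<rho> ennreal_less_iff)
    then show "ennreal (\<rho> u v) < diam X \<rho>"
      using ennreal_le_diam[OF xy(1,2)] by (rule less_le_trans)
  qed
next
  fix \<rho> :: "'a \<Rightarrow> 'a \<Rightarrow> real" and D :: real
  assume \<rho>: "Ultrametric_space X \<rho>" and bounded: "bounded_space X \<rho>"
    and card: "infinite X \<or> 2 \<le> card X"
    and empty: "empty_graph (diametrical_graph X \<rho>)"
    and "D = enn2real (diam X \<rho>)"
  interpret Ultrametric_space X \<rho> by fact
  \<comment> \<open>Boundedness excludes the value \<infinity>, which \<open>enn2real\<close> would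
    send to 0.\<close>
  have diam: "diam X \<rho> = ennreal D" and "0 \<le> D"
    using bounded \<open>D = _\<close> by (simp_all add: bounded_space_def)
  have less_D: "\<rho> x y < D" if "x \<in> X" "y \<in> X" "x \<noteq> y" for x y
    using empty that unfolding empty_diametrical_graph_iff diam by (auto simp: ennreal_less_iff)
  have "X \<noteq> {}" "\<And>a. X \<noteq> {a}" using card by auto
  then obtain a b where "a \<in> X" "b \<in> X" "a \<noteq> b" by blast
  then have D: "0 < D" using less_D[of a b] nonneg[of a b] by linarith
  \<comment> \<open>Edges join distinct points only, so the diagonal is added here, once a pair of
    distinct points has given \<open>0 < D\<close>.\<close>
  have less_D: "\<rho> x y < D" if "x \<in> X" "y \<in> X" for x y
    using less_D[OF that] D that by (cases "x = y") auto
  \<comment> \<open>Outside \<open>X\<close> the quotient could be negative because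
    \<open>\<rho> x y\<close> may exceed \<open>D\<close> there; the value 0 keeps \<open>d\<close>
    nonnegative on the whole type.\<close>
  define d where "d x y = (if x \<in> X \<and> y \<in> X then \<rho> x y / (D - \<rho> x y) else 0)" for x y
  have d_nonneg: "0 \<le> d x y" for x y
    using less_D by (auto simp: d_def less_imp_le)
  have \<rho>_d: "\<rho> x y = D * d x y / (1 + d x y)" if "x \<in> X" "y \<in> X" for x y
    using unbounding_map_inverse[OF D less_D[OF that]] that by (simp add: d_def)
  have "Ultrametric_space X d"
    using \<rho> strict_mono_on_unbounding_map[of D]
    by (rule Ultrametric_space_strict_mono) (use D less_D d_nonneg commute in \<open>auto simp: d_def\<close>)
  moreover have "\<not> bounded_space X d"
  proof
    assume "bounded_space X d"
    then obtain M where M: "0 \<le> M" "\<And>x y. \<lbrakk>x \<in> X; y \<in> X\<rbrakk> \<Longrightarrow> d x y \<le> M"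
      unfolding bounded_space_iff by blast
    \<comment> \<open>A bound \<open>M\<close> on \<open>d\<close> would bound \<open>\<rho>\<close>
      by the image of \<open>M\<close>, which lies strictly below the supremum
      \<open>D\<close>.\<close>
    have "\<rho> x y \<le> D * M / (1 + M)" if "x \<in> X" "y \<in> X" for x y
      unfolding \<rho>_d[OF that]
      using strict_mono_on_leD[OF strict_mono_on_bounding_map[OF D]] M d_nonneg that by simp
    then have "diam X \<rho> \<le> ennreal (D * M / (1 + M))"
      using D M(1) by (subst diam_le_ennreal_iff) auto
    then have "D \<le> D * M / (1 + M)"
      using D M(1) by (simp add: diam)
    then show False using D M(1) by (simp add: field_simps)
  qed
  ultimately show "\<exists>d. Ultrametric_space X d \<and> \<not> bounded_space X d \<and>
      (\<forall>x\<in>X. \<forall>y\<in>X. \<rho> x y = D * d x y / (1 + d x y))"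
    using \<rho>_d by blast
qed

end
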